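(* Let $\sigma$ be a permutation of $\mathbb{N}_0$. If there exists $p_0\in(2,\infty)$ such that $$\liminf_{n\to\infty} n^{1/p_0-1}\|F^\sigma_n\|_{p_0}=0,$$ then, for all $p\in(1,\infty)$ with $p\ne2$, the systems $(e_k)_{k\ge0}$ and $(w_{\sigma(k)})_{k\ge0}$ are not equivalent in $L_p$.
   Context: $\mathbb{N}_0=\{0,1,2,\ldots\}$. On $[0,1]$, $e_n(t)=\exp(2\pi i n t)$; $r_0,r_1,\ldots$ are the Rademacher functions ($r_i(t)=\operatorname{sign}\sin(2^{i+1}\pi t)$), and for $n=\sum_{i\ge0}n_i2^i$ with $n_i\in\{0,1\}$ the $n$-th Walsh function is $w_n=\prod_{i\ge 0} r_i^{n_i}$. Two systems $(a_k)_{k\ge0}$, $(b_k)_{k\ge0}$ in $L_p[0,1]$ are equivalent in $L_p$ if there is $c>0$ such that $\frac1c\|\sum_k\xi_k a_k\|_p\le\|\sum_k\xi_k b_k\|_p\le c\|\sum_k\xi_k a_k\|_p$ for all complex sequences $(\xi_k)_{k\ge0}$ with finitely many nonzero terms; here $\|\cdot\|_p$ is the norm of $L_p[0,1]$. For $n\ge1$, $F^\sigma_n(s,t)=\sum_{k=0}^{n-1}e_k(s)w_{\sigma(k)}(t)$ on $[0,1]^2$, and $\|F^\sigma_n\|_p$ denotes its norm in $L_p([0,1]^2)$. *)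

theory Defs
  imports "HOL-Analysis.Analysis"
begin

(* Meant for f measurable with |f|^p integrable and p > 0 (the Bochner integral of a
   non-integrable function is 0); all functions it is applied to are measurable and bounded. *)
definition Lp_norm :: "'a measure \<Rightarrow> real \<Rightarrow> ('a \<Rightarrow> complex) \<Rightarrow> real" where
  "Lp_norm M p f = (\<integral>x. norm (f x) powr p \<partial>M) powr (1 / p)"

abbreviation unit_interval_measure :: "real measure" where
  "unit_interval_measure \<equiv> restrict_space lborel {0..1}"

abbreviation unit_square_measure :: "(real \<times> real) measure" where
  "unit_square_measure \<equiv> unit_interval_measure \<Otimes>\<^sub>M unit_interval_measure"

definition equivalent_in_Lp ::
    "real \<Rightarrow> (nat \<Rightarrow> real \<Rightarrow> complex) \<Rightarrow> (nat \<Rightarrow> real \<Rightarrow> complex) \<Rightarrow> bool" where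
  "equivalent_in_Lp p a b \<longleftrightarrow>
    (\<exists>c>0. \<forall>\<xi> :: nat \<Rightarrow> complex. finite {k. \<xi> k \<noteq> 0} \<longrightarrow>
       (1 / c) * Lp_norm unit_interval_measure p (\<lambda>t. \<Sum>k | \<xi> k \<noteq> 0. \<xi> k * a k t)
         \<le> Lp_norm unit_interval_measure p (\<lambda>t. \<Sum>k | \<xi> k \<noteq> 0. \<xi> k * b k t) \<and>
       Lp_norm unit_interval_measure p (\<lambda>t. \<Sum>k | \<xi> k \<noteq> 0. \<xi> k * b k t)
         \<le> c * Lp_norm unit_interval_measure p (\<lambda>t. \<Sum>k | \<xi> k \<noteq> 0. \<xi> k * a k t))"

definition trig :: "nat \<Rightarrow> real \<Rightarrow> complex" where
  "trig n t = exp (2 * of_real pi * \<i> * of_nat n * of_real t)"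

definition rademacher :: "nat \<Rightarrow> real \<Rightarrow> real" where
  "rademacher i t = sgn (sin (2 ^ (i + 1) * pi * t))"

(* The factors r_i^0 = 1 are omitted; what remains is a finite product (finite_bits_nat). *)
definition walsh :: "nat \<Rightarrow> real \<Rightarrow> complex" where
  "walsh n t = (\<Prod>i | bit n i. complex_of_real (rademacher i t))"

lemma finite_bits_nat: "finite {i. bit (n :: nat) i}"
proof (rule finite_subset)
  show "{i. bit n i} \<subseteq> {..n}"
  proof
    fix i assume "i \<in> {i. bit n i}"
    then have "odd (n div 2 ^ i)" by (simp add: bit_iff_odd)
    then have "\<not> n < 2 ^ i" by (auto dest: div_less)
    moreover have "i < (2 :: nat) ^ i" by (rule less_exp)
    ultimately have "i \<le> n" by linarith
    then show "i \<in> {..n}" by simp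
  qed
qed simp

definition mixed_kernel :: "(nat \<Rightarrow> nat) \<Rightarrow> nat \<Rightarrow> real \<times> real \<Rightarrow> complex" where
  "mixed_kernel \<sigma> n = (\<lambda>(s, t). \<Sum>k<n. trig k s * walsh (\<sigma> k) t)"

end

theory Submission
  imports Defs
begin

text \<open>
Measure how peaked the kernel \<open>F\<^sub>n = mixed_kernel \<sigma> n\<close> is by
\<open>N\<^sub>n(q) = n \<integral>(\<bar>F\<^sub>n\<bar> / n)\<^sup>q\<close>, which is \<open>concentration \<sigma> n q\<close>. This normalisation of
the \<open>q\<close>-th power of the \<open>L\<^sub>q\<close> norm is such that a kernel behaving like the Dirichlet kernel, of
size \<open>n\<close> on a set of measure \<open>1 / n\<close>, has \<open>N\<^sub>n(q)\<close> of order 1 for every \<open>q > 1\<close>.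
The exponent of \<open>n\<close> in the hypothesis is exactly the one for which the hypothesis says that
\<open>N\<^sub>n(p\<^sub>0)\<close> gets arbitrarily small (\<open>small_concentration\<close>). On the other hand
\<open>N\<^sub>n(2) = 1\<close> for every \<open>n \<ge> 1\<close>, because the exponentials are orthonormal and the
Walsh functions are unimodular almost everywhere (\<open>concentration_2\<close>).

Suppose that the systems are equivalent in \<open>L\<^sub>p\<close>. Freeze \<open>s\<close> and use the numbers
\<open>e\<^sub>k(s)\<close>, \<open>k < n\<close>, as coefficients. Since \<open>e\<^sub>k(s) e\<^sub>k(t) = e\<^sub>k(s + t)\<close>, the equivalence
compares \<open>F\<^sub>n(s, \<cdot>)\<close> with a translate of the Dirichlet kernel. Integrating
over \<open>s\<close> shows that \<open>N\<^sub>n(p)\<close> lies between two positive constants, uniformly in \<open>n\<close>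
(\<open>equivalent_imp_concentration_lower\<close> and \<open>equivalent_imp_concentration_upper\<close>).

These facts contradict each other by interpolation between exponents, in the elementary form
\<open>x\<^sup>q \<le> \<epsilon> x\<^sup>r + K x\<^sup>s\<close> for \<open>r < q < s\<close> (\<open>concentration_interpolation\<close>). If \<open>p \<ge> p\<^sub>0\<close>, then
\<open>N\<^sub>n(p) \<le> N\<^sub>n(p\<^sub>0)\<close> because \<open>\<bar>F\<^sub>n\<bar> \<le> n\<close>. If \<open>2 < p < p\<^sub>0\<close>, then \<open>N\<^sub>n(p)\<close> is squeezed between
\<open>N\<^sub>n(2) = 1\<close> and \<open>N\<^sub>n(p\<^sub>0)\<close>. In both cases \<open>N\<^sub>n(p)\<close> gets arbitrarily small, against the lower bound.
If \<open>p < 2\<close>, then \<open>N\<^sub>n(2)\<close> is squeezed between the bounded \<open>N\<^sub>n(p)\<close> and the small \<open>N\<^sub>n(p\<^sub>0)\<close>,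
so \<open>N\<^sub>n(2)\<close> gets arbitrarily small too, although it equals 1. At \<open>p = 2\<close> no contradiction
arises.
\<close>

section \<open>Exponentials and Walsh functions\<close>

lemma norm_trig [simp]: "norm (trig n t) = 1"
  using norm_exp_i_times[of "2 * pi * n * t"] by (simp add: trig_def mult_ac)

lemma trig_nonzero [simp]: "trig n t \<noteq> 0"
  by (simp add: trig_def)

lemma trig_add: "trig n (s + t) = trig n s * trig n t"
  by (simp add: trig_def ring_distribs flip: exp_add)

lemma trig_power: "trig n t = trig 1 t ^ n"
  by (simp add: trig_def mult_ac flip: exp_of_nat_mult)

lemma trig_of_nat [simp]: "trig n (real j) = 1"
proof -
  have "trig n (real j) = exp (\<i> * (of_real (2 * pi) * of_int (int (n * j))))"
    by (simp add: trig_def mult_ac)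
  then show ?thesis by (metis exp_2pi_1_int mult.commute of_real_mult of_real_numeral)
qed

lemma trig_diff_of_nat: "trig n (t - real j) = trig n t"
  using trig_add[of n "t - real j" "real j"] by simp

lemma Re_trig: "Re (trig n t) = cos (2 * pi * n * t)"
proof -
  have "trig n t = cis (2 * pi * n * t)" by (simp add: trig_def cis_conv_exp mult_ac)
  then show ?thesis by simp
qed

lemma continuous_on_trig [continuous_intros]: "continuous_on A (trig n)"
  unfolding trig_def by (intro continuous_intros)

lemma borel_measurable_trig [measurable]: "trig n \<in> borel_measurable borel"
  by (intro borel_measurable_continuous_onI continuous_intros)

lemma borel_measurable_rademacher [measurable]: "rademacher i \<in> borel_measurable borel"
  unfolding rademacher_def by measurable

lemma borel_measurable_walsh [measurable]: "walsh n \<in> borel_measurable borel"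
  unfolding walsh_def by measurable

lemma norm_walsh_le: "norm (walsh n t) \<le> 1"
  unfolding walsh_def
  by (simp flip: prod_norm) (intro prod_le_1, auto simp: rademacher_def sgn_if)

lemma countable_rademacher_zeros: "countable {t. rademacher i t = 0}"
proof (rule countable_subset)
  show "{t. rademacher i t = 0} \<subseteq> (\<lambda>m::int. of_int m / 2 ^ (i + 1)) ` UNIV"
  proof
    fix t assume "t \<in> {t. rademacher i t = 0}"
    then have "sin (2 ^ (i + 1) * pi * t) = 0" by (simp add: rademacher_def sgn_eq_0_iff)
    then obtain m :: int where "2 ^ (i + 1) * pi * t = of_int m * pi"
      by (auto simp: sin_zero_iff_int2)
    then have "pi * (2 ^ (i + 1) * t) = pi * of_int m" by (simp only: mult_ac)
    then have "t = of_int m / 2 ^ (i + 1)" by (simp add: field_simps)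
    then show "t \<in> (\<lambda>m::int. of_int m / 2 ^ (i + 1)) ` UNIV" by blast
  qed
qed simp

text \<open>The Walsh functions fail to be unimodular only where the sine inside some Rademacher function
vanishes, that is, at dyadic rationals.\<close>

lemma AE_norm_walsh: "AE t in lborel. \<forall>n. norm (walsh n t) = 1"
proof -
  have "countable (\<Union>i. {t. rademacher i t = 0})"
    by (intro countable_UN countable_rademacher_zeros) auto
  then have "AE t in lborel. t \<notin> (\<Union>i. {t. rademacher i t = 0})"
    by (intro AE_not_in countable_imp_null_set_lborel)
  then show ?thesis
  proof eventually_elim
    case (elim t)
    have "\<bar>rademacher i t\<bar> = 1" for i
      using elim by (auto simp: rademacher_def sgn_if split: if_splits)
    then show ?case by (simp add: walsh_def flip: prod_norm)
  qed
qed

section \<open>Pointwise bounds for the Dirichlet kernel\<close>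

abbreviation dirichlet_kernel :: "nat \<Rightarrow> real \<Rightarrow> complex" where
  "dirichlet_kernel n u \<equiv> \<Sum>k<n. trig k u"

lemma norm_sum_le_card:
  fixes f :: "nat \<Rightarrow> complex"
  assumes "\<And>k. norm (f k) \<le> 1"
  shows "norm (\<Sum>k<n. f k) \<le> n"
  using sum_norm_le[of "{..<n}" f "\<lambda>_. 1"] assms by simp

text \<open>Jordan's inequality: by concavity the sine lies above its chord from \<open>0\<close> to \<open>pi / 2\<close>.\<close>

lemma sin_pi_ge:
  assumes "0 \<le> x" "x \<le> 1 / 2"
  shows "sin (pi * x) \<ge> 2 * x"
proof -
  have "convex_on {0..pi} (\<lambda>x. - sin x)"
    by (rule f''_ge0_imp_convex[where f' = "\<lambda>x. - cos x" and f'' = sin])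
       (auto intro!: derivative_eq_intros sin_ge_zero)
  from convex_onD[OF this, of "2 * x" 0 "pi / 2"] assms show ?thesis
    by (simp add: mult_ac)
qed

text \<open>Near the integer \<open>j\<close> put \<open>x = u - j\<close>. The trivial bound \<open>n\<close> and the bound \<open>1 / (2 \<bar>x\<bar>)\<close> from
the geometric sum are merged into one expression in the rescaled variable \<open>n x\<close>, so that
later integrals do not depend on \<open>n\<close>.\<close>

lemma norm_dirichlet_kernel_le:
  assumes "n > 0" "\<bar>u - real j\<bar> \<le> 1 / 2"
  shows "norm (dirichlet_kernel n u) / n \<le> 2 / (1 + 2 * \<bar>n * (u - real j)\<bar>)"
proof -
  define x where "x = u - real j"
  define D where "D = norm (dirichlet_kernel n u)"
  have "dirichlet_kernel n u = dirichlet_kernel n x"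
    by (simp add: x_def trig_diff_of_nat)
  then have D: "D = norm (\<Sum>k<n. trig 1 x ^ k)" by (simp only: D_def trig_power[symmetric])
  have "(1 - trig 1 x) * (\<Sum>k<n. trig 1 x ^ k) = 1 - trig n x"
    by (simp add: one_diff_power_eq trig_power[of n])
  then have "norm (1 - trig 1 x) * D = norm (1 - trig n x)"
    unfolding D by (metis norm_mult)
  also have "\<dots> \<le> 2" using norm_triangle_ineq4[of 1 "trig n x"] by simp
  finally have 1: "norm (1 - trig 1 x) * D \<le> 2" .
  have "norm (1 - trig 1 x) = 2 * \<bar>sin (pi * x)\<bar>"
    using dist_exp_i_1[of "2 * pi * x"] by (simp add: norm_minus_commute trig_def mult_ac)
  moreover have "\<bar>sin (pi * x)\<bar> = \<bar>sin (pi * \<bar>x\<bar>)\<bar>"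
    by (cases "x \<ge> 0") simp_all
  moreover have "sin (pi * \<bar>x\<bar>) \<ge> 2 * \<bar>x\<bar>"
    by (rule sin_pi_ge) (use assms(2) in \<open>auto simp: x_def\<close>)
  ultimately have "4 * \<bar>x\<bar> * D \<le> norm (1 - trig 1 x) * D"
    by (intro mult_right_mono) (auto simp: D_def)
  with 1 have 2: "2 * \<bar>x\<bar> * D \<le> 1" by simp
  have 3: "D \<le> n" unfolding D_def by (rule norm_sum_le_card) simp
  have "D * (1 + 2 * \<bar>n * x\<bar>) = D + n * (2 * \<bar>x\<bar> * D)" by (simp add: algebra_simps abs_mult)
  also have "\<dots> \<le> real n + real n * 1" using 2 3 by (intro add_mono mult_left_mono) auto
  finally show ?thesis using assms(1) unfolding D_def[symmetric] x_def[symmetric]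
    by (simp add: field_simps add_pos_nonneg)
qed

text \<open>Within distance \<open>1 / (6 n)\<close> of an integer all \<open>n\<close> summands have an argument of at most
\<open>pi / 3\<close> in absolute value, so each has real part at least \<open>1 / 2\<close> and there is no cancellation.\<close>

lemma norm_dirichlet_kernel_ge:
  assumes "\<bar>n * (u - real j)\<bar> \<le> 1 / 6"
  shows "norm (dirichlet_kernel n u) \<ge> n / 2"
proof -
  have "1 / 2 \<le> Re (trig k u)" if "k < n" for k
  proof -
    have "\<bar>real k * (u - real j)\<bar> \<le> \<bar>n * (u - real j)\<bar>"
      using that by (simp add: abs_mult mult_right_mono)
    with assms have "\<bar>real k * (u - real j)\<bar> \<le> 1 / 6" by simp
    then have "2 * pi * \<bar>real k * (u - real j)\<bar> \<le> 2 * pi * (1 / 6)"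
      by (intro mult_left_mono) auto
    also have "2 * pi * \<bar>real k * (u - real j)\<bar> = \<bar>2 * pi * k * (u - real j)\<bar>"
      by (simp only: abs_mult) simp
    finally have *: "\<bar>2 * pi * k * (u - real j)\<bar> \<le> pi / 3" by simp
    have "cos (pi / 3) \<le> cos \<bar>2 * pi * k * (u - real j)\<bar>"
      by (rule cos_monotone_0_pi_le) (use * in auto)
    then have "1 / 2 \<le> Re (trig k (u - real j))"
      unfolding Re_trig by (simp only: cos_abs_real cos_60)
    then show ?thesis by (simp add: trig_diff_of_nat)
  qed
  then have "(\<Sum>k<n. 1 / 2) \<le> (\<Sum>k<n. Re (trig k u))" by (intro sum_mono) auto
  also have "\<dots> \<le> norm (dirichlet_kernel n u)"
    using complex_Re_le_cmod[of "dirichlet_kernel n u"] by simp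
  finally show ?thesis by simp
qed

text \<open>The majorant of the rescaled Dirichlet kernel is integrable on the whole line; this is where
\<open>p > 1\<close> enters.\<close>

lemma nn_integral_decay_finite:
  assumes "p > 1"
  shows "(\<integral>\<^sup>+y. ennreal ((2 / (1 + 2 * \<bar>y\<bar>)) powr p) \<partial>lborel) < \<infinity>"
proof -
  let ?G = "\<lambda>y::real. (2 / (1 + 2 * \<bar>y\<bar>)) powr p"
  let ?g = "\<lambda>y::real. ennreal (?G y) * indicator {0..} y"
  have "(\<integral>\<^sup>+y. ?g y \<partial>lborel) = ennreal (0 - (- (2 powr p * (1 + 2 * 0) powr (1 - p) / (2 * (p - 1)))))"
  proof (rule nn_integral_FTC_atLeast)
    show "((\<lambda>y. - (2 powr p * (1 + 2 * y) powr (1 - p) / (2 * (p - 1))) :: real) \<longlongrightarrow> 0) at_top"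
    proof -
      have "filterlim (\<lambda>y::real. 1 + 2 * y) at_top at_top"
        by (intro filterlim_tendsto_add_at_top[OF tendsto_const]
              filterlim_tendsto_pos_mult_at_top[OF tendsto_const] filterlim_ident) simp
      then have "((\<lambda>y::real. (1 + 2 * y) powr (1 - p)) \<longlongrightarrow> 0) at_top"
        by (rule tendsto_neg_powr[rotated]) (use assms in simp)
      then have "((\<lambda>y::real. - (2 powr p * (1 + 2 * y) powr (1 - p) / (2 * (p - 1)))) \<longlongrightarrow>
          - (2 powr p * 0 / (2 * (p - 1)))) at_top"
        by (intro tendsto_intros) (use assms in auto)
      then show ?thesis by simp
    qed
    fix y :: real assume "0 \<le> y"
    then have "((\<lambda>y. - (2 powr p * (1 + 2 * y) powr (1 - p) / (2 * (p - 1)))) has_real_derivative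
        - (2 powr p * ((1 - p) * (1 + 2 * y) powr (1 - p - 1) * 2) / (2 * (p - 1)))) (at y)"
      using assms by (auto intro!: derivative_eq_intros)
    moreover have "- (2 powr p * ((1 - p) * (1 + 2 * y) powr (1 - p - 1) * 2) / (2 * (p - 1)))
        = 2 powr p * (1 + 2 * y) powr (- p)"
      using assms by (simp add: field_simps)
    moreover have "2 powr p * (1 + 2 * y) powr (- p) = ?G y"
      using \<open>0 \<le> y\<close> by (simp add: powr_divide powr_minus_divide)
    ultimately show "((\<lambda>y. - (2 powr p * (1 + 2 * y) powr (1 - p) / (2 * (p - 1)))) has_real_derivative ?G y) (at y)"
      by simp
  qed auto
  then have fin: "(\<integral>\<^sup>+y. ?g y \<partial>lborel) < \<infinity>" by simp
  \<comment> \<open>The integrand is even, so reflection handles the negative half-line.\<close>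
  have "(\<integral>\<^sup>+y. ?g (0 + (- 1) * y) \<partial>lborel) = (\<integral>\<^sup>+y. ?g y \<partial>lborel)"
    by (subst (2) nn_integral_real_affine[of _ "- 1" 0]) auto
  with fin have "(\<integral>\<^sup>+y. ?g y + ?g (0 + (- 1) * y) \<partial>lborel) < \<infinity>"
    by (subst nn_integral_add) auto
  moreover have "(\<integral>\<^sup>+y. ennreal (?G y) \<partial>lborel) \<le> (\<integral>\<^sup>+y. ?g y + ?g (0 + (- 1) * y) \<partial>lborel)"
    by (intro nn_integral_mono) (auto simp: indicator_def)
  ultimately show ?thesis by (rule le_less_trans[rotated])
qed

section \<open>Integration over the unit interval and the unit square\<close>

lemma borel_measurable_unit_interval:
  "f \<in> borel_measurable borel \<Longrightarrow> f \<in> borel_measurable unit_interval_measure"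
  by (rule measurable_restrict_space1) simp

lemma measurable_ident_unit_interval [measurable]: "(\<lambda>x. x) \<in> unit_interval_measure \<rightarrow>\<^sub>M borel"
  by (rule measurable_restrict_space1) simp

lemma space_unit_interval [simp]: "space unit_interval_measure = {0..1}"
  by (simp add: space_restrict_space)

lemma measure_unit_interval [simp]: "measure unit_interval_measure {0..1} = 1"
  by (simp add: measure_restrict_space)

lemma finite_measure_unit_interval: "finite_measure unit_interval_measure"
proof (rule finite_measureI)
  show "emeasure unit_interval_measure (space unit_interval_measure) \<noteq> \<infinity>"
    by (subst emeasure_restrict_space) auto
qed

interpretation unit_interval: finite_measure unit_interval_measure
  by (rule finite_measure_unit_interval)

interpretation unit_square: pair_sigma_finite unit_interval_measure unit_interval_measure ..

interpretation unit_square: finite_measure unit_square_measure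
  by (intro finite_measure_pair_measure finite_measure_unit_interval)

lemma borel_measurable_mixed_kernel [measurable]:
  "mixed_kernel \<sigma> n \<in> borel_measurable unit_square_measure"
  unfolding mixed_kernel_def case_prod_beta
  by measurable

lemma norm_mixed_kernel_le: "norm (mixed_kernel \<sigma> n z) \<le> n"
  unfolding mixed_kernel_def case_prod_beta
  by (intro norm_sum_le_card) (simp add: norm_mult norm_walsh_le)

lemma trig_orthogonal:
  "(\<integral>s. trig j s * cnj (trig k s) \<partial>unit_interval_measure) = (if j = k then 1 else 0)"
proof (cases "j = k")
  case True
  have "trig j s * cnj (trig j s) = 1" for s
    by (simp flip: complex_norm_square)
  then show ?thesis using True by simp
next
  case False
  define a :: complex where "a = 2 * of_real pi * \<i> * (of_nat j - of_nat k)"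
  have a: "a \<noteq> 0" using False by (simp add: a_def)
  have e: "trig j s * cnj (trig k s) = exp (a * of_real s)" for s
    by (simp add: trig_def exp_cnj a_def algebra_simps flip: exp_add)
  have "(\<integral>s. indicator {0..1} s *\<^sub>R exp (a * of_real s) \<partial>lborel)
      = exp (a * of_real 1) / a - exp (a * of_real 0) / a"
  proof (rule integral_FTC_Icc)
    fix x :: real
    have "((\<lambda>z. exp (a * z) / a) has_field_derivative exp (a * of_real x)) (at (of_real x))"
      using a by (auto intro!: derivative_eq_intros)
    from has_vector_derivative_real_field[OF this]
    show "((\<lambda>s. exp (a * of_real s) / a) has_vector_derivative exp (a * of_real x))
        (at x within {0..1})" .
  qed (auto intro!: continuous_intros)
  also have "exp (a * of_real 1) = 1"
    using e[of 1] trig_of_nat[of _ 1] by simp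
  finally show ?thesis using False by (simp add: e integral_restrict_space)
qed

lemma trig_parseval:
  "(\<integral>s. (norm (\<Sum>k<n. c k * trig k s))\<^sup>2 \<partial>unit_interval_measure) = (\<Sum>k<n. (norm (c k))\<^sup>2)"
proof -
  have int: "integrable unit_interval_measure (\<lambda>s. c j * cnj (c k) * (trig j s * cnj (trig k s)))" for j k
    by (rule unit_interval.integrable_const_bound[where B = "norm (c j * cnj (c k))"])
       (auto simp: norm_mult intro!: borel_measurable_unit_interval
         borel_measurable_continuous_onI continuous_intros)
  have expand: "complex_of_real ((norm (\<Sum>k<n. c k * trig k s))\<^sup>2)
      = (\<Sum>j<n. \<Sum>k<n. c j * cnj (c k) * (trig j s * cnj (trig k s)))" for s
  proof -
    have "complex_of_real ((norm (\<Sum>k<n. c k * trig k s))\<^sup>2)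
        = (\<Sum>j<n. c j * trig j s) * (\<Sum>k<n. cnj (c k) * cnj (trig k s))"
      by (simp only: complex_norm_square cnj_sum complex_cnj_mult)
    then show ?thesis by (simp only: sum_product mult.assoc mult.left_commute)
  qed
  have "complex_of_real (\<integral>s. (norm (\<Sum>k<n. c k * trig k s))\<^sup>2 \<partial>unit_interval_measure)
      = (\<integral>s. (\<Sum>j<n. \<Sum>k<n. c j * cnj (c k) * (trig j s * cnj (trig k s))) \<partial>unit_interval_measure)"
    unfolding integral_complex_of_real[symmetric] expand ..
  also have "\<dots> = (\<Sum>j<n. \<Sum>k<n. c j * cnj (c k) * (if j = k then 1 else 0))"
    by (simp only: Bochner_Integration.integral_sum Bochner_Integration.integrable_sum int
        integral_mult_right_zero trig_orthogonal)
  also have "\<dots> = of_real (\<Sum>k<n. (norm (c k))\<^sup>2)"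
    by (simp add: complex_norm_square if_distrib[of "\<lambda>x. _ * x"] del: of_real_power cong: if_cong)
  finally show ?thesis by (simp only: of_real_eq_iff)
qed

section \<open>Concentration of the mixed kernel\<close>

text \<open>The \<open>q\<close>-th power of the \<open>L\<^sub>q\<close> norm of the kernel, divided by \<open>n\<^sup>q\<^sup>-\<^sup>1\<close>. Keeping the
factor \<open>1 / n\<close> inside makes the base of the power lie in \<open>[0, 1]\<close>.\<close>

definition concentration :: "(nat \<Rightarrow> nat) \<Rightarrow> nat \<Rightarrow> real \<Rightarrow> real" where
  "concentration \<sigma> n q = n * (\<integral>z. (norm (mixed_kernel \<sigma> n z) / n) powr q \<partial>unit_square_measure)"

lemma norm_div_powr_le_1:
  assumes "norm x \<le> real n" "q \<ge> 0"
  shows "(norm (x::complex) / n) powr q \<le> 1"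
  using assms by (cases "n = 0") (auto simp: powr_le_one_le intro!: powr_le1)

lemma integrable_concentration:
  assumes "q \<ge> 0"
  shows "integrable unit_square_measure (\<lambda>z. (norm (mixed_kernel \<sigma> n z) / n) powr q)"
  by (rule unit_square.integrable_const_bound[where B = 1])
     (simp_all add: norm_div_powr_le_1 norm_mixed_kernel_le assms)

text \<open>For almost every \<open>t\<close> the kernel is, as a function of \<open>s\<close>, a trigonometric polynomial with \<open>n\<close>
unimodular coefficients, so Parseval's identity in \<open>s\<close> gives mean square \<open>n\<close>.\<close>

lemma concentration_2:
  assumes "n > 0"
  shows "concentration \<sigma> n 2 = 1"
proof -
  let ?f = "\<lambda>z. (norm (mixed_kernel \<sigma> n z) / n) powr 2"
  have "AE t in unit_interval_measure. \<forall>n. norm (walsh n t) = 1"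
    using AE_norm_walsh by (auto simp: AE_restrict_space_iff elim!: eventually_mono)
  then have "AE t in unit_interval_measure. (\<integral>s. ?f (s, t) \<partial>unit_interval_measure) = 1 / n"
  proof eventually_elim
    case (elim t)
    have "(\<integral>s. ?f (s, t) \<partial>unit_interval_measure)
        = (\<integral>s. (norm (\<Sum>k<n. walsh (\<sigma> k) t * trig k s))\<^sup>2 / (real n)\<^sup>2 \<partial>unit_interval_measure)"
      by (intro Bochner_Integration.integral_cong) (auto simp: mixed_kernel_def power_divide mult_ac)
    also have "\<dots> = (\<Sum>k<n. (norm (walsh (\<sigma> k) t))\<^sup>2) / (real n)\<^sup>2"
      by (simp only: integral_divide_zero trig_parseval)
    also have "\<dots> = 1 / n" using elim assms by (simp add: power2_eq_square)
    finally show ?case .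
  qed
  then have "(\<integral>t. (\<integral>s. ?f (s, t) \<partial>unit_interval_measure) \<partial>unit_interval_measure)
      = (\<integral>t. 1 / n \<partial>unit_interval_measure)"
    by (intro integral_cong_AE) auto
  then have "(\<integral>z. ?f z \<partial>unit_square_measure) = 1 / n"
    using unit_square.integral_snd[of "\<lambda>s t. ?f (s, t)"] integrable_concentration[of 2 \<sigma> n]
    by (simp add: split_beta')
  then show ?thesis using assms by (simp add: concentration_def)
qed

text \<open>Below the threshold \<open>a\<close> with \<open>a\<^sup>q\<^sup>-\<^sup>r = \<epsilon>\<close> the first term on the right dominates, above
it the second one. This replaces log-convexity of the \<open>L\<^sub>q\<close> norms and avoids tracking
interpolation exponents.\<close>

lemma powr_interpolation:
  fixes r q s \<epsilon> :: real
  assumes "r < q" "q < s" "\<epsilon> > 0"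
  obtains K where "K > 0" "\<And>x. x \<ge> 0 \<Longrightarrow> x powr q \<le> \<epsilon> * x powr r + K * x powr s"
proof
  define a where "a = \<epsilon> powr (1 / (q - r))"
  have a: "a > 0" "a powr (q - r) = \<epsilon>" using assms by (simp_all add: a_def powr_powr)
  show "a powr (q - s) > 0" using a by simp
  fix x :: real assume "x \<ge> 0"
  show "x powr q \<le> \<epsilon> * x powr r + a powr (q - s) * x powr s"
  proof (cases "x \<le> a")
    case True
    have "x powr q = x powr (q - r) * x powr r" by (simp flip: powr_add)
    also have "\<dots> \<le> \<epsilon> * x powr r"
      using True \<open>x \<ge> 0\<close> assms a powr_mono2[of "q - r" x a] by (intro mult_right_mono) auto
    also have "\<dots> \<le> \<epsilon> * x powr r + a powr (q - s) * x powr s" by simp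
    finally show ?thesis .
  next
    case False
    have "x powr q = x powr (q - s) * x powr s" by (simp flip: powr_add)
    also have "\<dots> \<le> a powr (q - s) * x powr s"
      using False assms a powr_mono2'[of "q - s" a x] by (intro mult_right_mono) auto
    also have "\<dots> \<le> \<epsilon> * x powr r + a powr (q - s) * x powr s" using assms by simp
    finally show ?thesis .
  qed
qed

text \<open>What matters is that \<open>K\<close> depends neither on \<open>\<sigma>\<close> nor on \<open>n\<close>: with the concentration at
\<open>r\<close> bounded, smallness at \<open>s\<close> forces smallness at \<open>q\<close>.\<close>

lemma concentration_interpolation:
  assumes "0 \<le> r" "r < q" "q < s" "\<epsilon> > 0"
  obtains K where "K > 0"
    "\<And>\<sigma> n. concentration \<sigma> n q \<le> \<epsilon> * concentration \<sigma> n r + K * concentration \<sigma> n s"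
proof -
  obtain K where K: "K > 0" "\<And>x. x \<ge> 0 \<Longrightarrow> x powr q \<le> \<epsilon> * x powr r + K * x powr s"
    by (rule powr_interpolation[OF assms(2-4)]) (rule that)
  have "concentration \<sigma> n q \<le> \<epsilon> * concentration \<sigma> n r + K * concentration \<sigma> n s" for \<sigma> n
  proof -
    let ?f = "\<lambda>q z. (norm (mixed_kernel \<sigma> n z) / n) powr q"
    have int: "integrable unit_square_measure (?f r)" "integrable unit_square_measure (?f q)"
        "integrable unit_square_measure (?f s)"
      using assms by (auto intro!: integrable_concentration)
    have "(\<integral>z. ?f q z \<partial>unit_square_measure) \<le> (\<integral>z. \<epsilon> * ?f r z + K * ?f s z \<partial>unit_square_measure)"
      using int K(2) by (intro integral_mono) auto
    also have "\<dots> = \<epsilon> * (\<integral>z. ?f r z \<partial>unit_square_measure) + K * (\<integral>z. ?f s z \<partial>unit_square_measure)"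
      using int by simp
    finally have "n * (\<integral>z. ?f q z \<partial>unit_square_measure)
        \<le> n * (\<epsilon> * (\<integral>z. ?f r z \<partial>unit_square_measure) + K * (\<integral>z. ?f s z \<partial>unit_square_measure))"
      by (intro mult_left_mono) auto
    then show ?thesis by (simp add: concentration_def algebra_simps)
  qed
  with K(1) show thesis by (rule that)
qed

lemma concentration_antimono:
  assumes "0 \<le> q" "q \<le> s"
  shows "concentration \<sigma> n s \<le> concentration \<sigma> n q"
proof -
  have "norm (mixed_kernel \<sigma> n z) / n \<le> 1" for z
    using norm_mixed_kernel_le[of \<sigma> n z] by (cases "n = 0") auto
  then show ?thesis
    unfolding concentration_def using assms
    by (intro mult_left_mono integral_mono integrable_concentration powr_mono') auto
qed

section \<open>Slices of the Dirichlet kernel\<close>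

definition slice_concentration :: "(real \<Rightarrow> complex) \<Rightarrow> nat \<Rightarrow> real \<Rightarrow> real" where
  "slice_concentration f n q = n * (\<integral>t. (norm (f t) / n) powr q \<partial>unit_interval_measure)"

lemma concentration_eq_integral_slices:
  assumes "q \<ge> 0"
  shows "concentration \<sigma> n q
      = (\<integral>s. slice_concentration (\<lambda>t. mixed_kernel \<sigma> n (s, t)) n q \<partial>unit_interval_measure)"
    "integrable unit_interval_measure
      (\<lambda>s. slice_concentration (\<lambda>t. mixed_kernel \<sigma> n (s, t)) n q)"
  using unit_square.integral_fst'[OF integrable_concentration[OF assms, of \<sigma> n]]
    unit_square.integrable_fst'[OF integrable_concentration[OF assms, of \<sigma> n]]
  by (simp_all add: concentration_def slice_concentration_def)

text \<open>For \<open>s\<close> and \<open>t\<close> in the unit interval, \<open>s + t\<close> is within \<open>1 / 2\<close> of one of the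
integers \<open>0\<close>, \<open>1\<close>, \<open>2\<close>. So three translates of the rescaled majorant dominate the slice, and the
change of variables \<open>y = n (s + t - j)\<close> makes their integrals independent of \<open>n\<close> and \<open>s\<close>.\<close>

lemma dirichlet_kernel_slice_upper:
  assumes "p > 1"
  obtains C where "C > 0" "\<And>n s. n > 0 \<Longrightarrow> s \<in> {0..1} \<Longrightarrow>
    slice_concentration (\<lambda>t. dirichlet_kernel n (s + t)) n p \<le> C"
proof -
  define G where "G = (\<lambda>y::real. (2 / (1 + 2 * \<bar>y\<bar>)) powr p)"
  have [measurable]: "G \<in> borel_measurable borel" by (simp add: G_def)
  define I where "I = enn2real (\<integral>\<^sup>+y. ennreal (G y) \<partial>lborel)"
  have I: "(\<integral>\<^sup>+y. ennreal (G y) \<partial>lborel) = ennreal I"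
    using nn_integral_decay_finite[OF assms] by (simp add: I_def G_def)
  have "I \<ge> 0" by (simp add: I_def)
  have "slice_concentration (\<lambda>t. dirichlet_kernel n (s + t)) n p \<le> 3 * I"
    if n: "n > 0" and s: "s \<in> {0..1}" for n s
  proof -
    let ?f = "\<lambda>t::real. (norm (dirichlet_kernel n (s + t)) / n) powr p"
    have int: "integrable unit_interval_measure ?f"
      by (rule unit_interval.integrable_const_bound[where B = 1])
         (use assms in \<open>auto intro!: norm_div_powr_le_1 norm_sum_le_card\<close>)
    have scale: "ennreal n * (\<integral>\<^sup>+t. ennreal (G (n * (s - real j) + n * t)) \<partial>lborel) = ennreal I" for j
      using n I by (subst (asm) nn_integral_real_affine[of _ n "n * (s - real j)"]) auto
    have pointwise: "?f t \<le> (\<Sum>j<3. G (n * (s - real j) + n * t))" if t: "t \<in> {0..1}" for t :: real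
    proof -
      obtain j where j: "j < 3" "\<bar>s + t - real j\<bar> \<le> 1 / 2"
      proof (cases "s + t \<le> 1 / 2")
        case True with s t show ?thesis by (intro that[of 0]) auto
      next
        case F: False
        show ?thesis
        proof (cases "s + t \<le> 3 / 2")
          case True with F have "\<bar>s + t - real 1\<bar> \<le> 1 / 2" unfolding abs_le_iff by simp
          then show ?thesis by (intro that[of 1]) auto
        next
          case False with s t show ?thesis by (intro that[of 2]) auto
        qed
      qed
      have "?f t \<le> G (n * (s + t - real j))"
        unfolding G_def using assms norm_dirichlet_kernel_le[OF n j(2)]
        by (intro powr_mono2) auto
      also have "\<dots> = G (n * (s - real j) + n * t)" by (simp add: algebra_simps)
      also have "\<dots> \<le> (\<Sum>j<3. G (n * (s - real j) + n * t))"
        using j(1) by (intro member_le_sum) (auto simp: G_def)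
      finally show ?thesis .
    qed
    have "ennreal (n * (\<integral>t. ?f t \<partial>unit_interval_measure))
        = ennreal n * (\<integral>\<^sup>+t. ennreal (?f t) \<partial>unit_interval_measure)"
      using int by (simp add: nn_integral_eq_integral ennreal_mult)
    also have "\<dots> = ennreal n * (\<integral>\<^sup>+t. ennreal (?f t) * indicator {0..1} t \<partial>lborel)"
      by (subst nn_integral_restrict_space) auto
    also have "\<dots> \<le> ennreal n * (\<integral>\<^sup>+t. (\<Sum>j<3. ennreal (G (n * (s - real j) + n * t))) \<partial>lborel)"
      using pointwise
      by (intro mult_left_mono nn_integral_mono)
         (auto simp: indicator_def sum_ennreal G_def intro!: ennreal_leI)
    also have "\<dots> = (\<Sum>j<3. ennreal n * (\<integral>\<^sup>+t. ennreal (G (n * (s - real j) + n * t)) \<partial>lborel))"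
      by (subst nn_integral_sum) (auto simp: sum_distrib_left)
    also have "\<dots> = ennreal (3 * I)"
      using \<open>I \<ge> 0\<close> by (simp add: scale ennreal_mult)
    finally show ?thesis using \<open>I \<ge> 0\<close> by (simp add: ennreal_le_iff slice_concentration_def)
  qed
  then have "slice_concentration (\<lambda>t. dirichlet_kernel n (s + t)) n p \<le> 3 * I + 1"
    if "n > 0" "s \<in> {0..1}" for n s
    using that by (meson add_increasing2 zero_le_one)
  with \<open>I \<ge> 0\<close> show thesis by (intro that[of "3 * I + 1"]) auto
qed

text \<open>The peak at \<open>s + t = 1\<close> meets the slice for every \<open>s\<close>: of the two intervals of length
\<open>1 / (6 n)\<close> that end or begin at \<open>t = 1 - s\<close>, at least one lies in the unit interval.\<close>

lemma dirichlet_kernel_slice_lower: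
  assumes "p > 0" "n > 0" "s \<in> {0..1}"
  shows "slice_concentration (\<lambda>t. dirichlet_kernel n (s + t)) n p
    \<ge> (1 / 2) powr p / 6"
proof -
  let ?f = "\<lambda>t. (norm (dirichlet_kernel n (s + t)) / n) powr p"
  define h where "h = 1 / (6 * real n)"
  have h: "h > 0" "h \<le> 1 / 6" "real n * h = 1 / 6" using assms by (simp_all add: h_def field_simps)
  define b where "b = (if s \<le> 1 / 2 then 1 - s - h else 1 - s)"
  define J where "J = {b..b + h}"
  have J: "J \<subseteq> {0..1}" using h(1,2) assms by (auto simp: J_def b_def)
  have near: "\<bar>real n * (s + t - real 1)\<bar> \<le> 1 / 6" if "t \<in> J" for t
  proof -
    have "\<bar>s + t - 1\<bar> \<le> h" using that h(1) by (auto simp: J_def b_def split: if_splits)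
    then have "real n * \<bar>s + t - 1\<bar> \<le> real n * h" by (intro mult_left_mono) auto
    then show ?thesis by (simp add: abs_mult h(3))
  qed
  have "measure unit_interval_measure J = h"
    using J h(1) by (subst measure_restrict_space) (auto simp: J_def)
  then have "(1 / 2) powr p / 6 = n * ((1 / 2) powr p * measure unit_interval_measure J)"
    using h(3) by simp
  also have "(1 / 2) powr p * measure unit_interval_measure J
      = (\<integral>t. (1 / 2) powr p * indicator J t \<partial>unit_interval_measure)"
    using J by (simp add: Int_absorb2)
  also have "\<dots> \<le> (\<integral>t. ?f t \<partial>unit_interval_measure)"
  proof (rule integral_mono)
    show "integrable unit_interval_measure (\<lambda>t. (1 / 2) powr p * indicator J t)"
      by (rule unit_interval.integrable_const_bound[where B = "(1 / 2) powr p"])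
         (auto simp: J_def indicator_def intro!: borel_measurable_unit_interval)
    show "integrable unit_interval_measure ?f"
      by (rule unit_interval.integrable_const_bound[where B = 1])
         (use assms in \<open>auto intro!: norm_div_powr_le_1 norm_sum_le_card\<close>)
    show "(1 / 2) powr p * indicator J t \<le> ?f t" for t
    proof (cases "t \<in> J")
      case True
      have "1 / 2 \<le> norm (dirichlet_kernel n (s + t)) / n"
        using norm_dirichlet_kernel_ge[OF near[OF True]] assms by (simp add: field_simps)
      then show ?thesis using True assms by (simp add: powr_mono2)
    qed simp
  qed
  finally show ?thesis by (simp add: mult_left_mono slice_concentration_def)
qed

section \<open>Consequences of equivalence\<close>

lemma powr_inverse_le_imp:
  fixes a b c p :: real
  assumes "a powr (1 / p) \<le> c * b powr (1 / p)" "a \<ge> 0" "b \<ge> 0" "c > 0" "p > 0"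
  shows "a \<le> c powr p * b"
proof -
  have "(a powr (1 / p)) powr p \<le> (c * b powr (1 / p)) powr p"
    using assms by (intro powr_mono2) auto
  then show ?thesis using assms by (simp add: powr_mult powr_powr)
qed

text \<open>The coefficients \<open>e\<^sub>k(s)\<close> turn the trigonometric sum into a translate of the Dirichlet kernel
and the Walsh sum into a slice of the mixed kernel. The constant is independent of \<open>n\<close> and
\<open>s\<close>, as integration over \<open>s\<close> requires.\<close>

lemma equivalent_in_Lp_slice:
  assumes "p > 0" "equivalent_in_Lp p trig (\<lambda>k. walsh (\<sigma> k))"
  obtains c where "c > 0"
    "\<And>n s. slice_concentration (\<lambda>t. dirichlet_kernel n (s + t)) n p \<le> c * slice_concentration (\<lambda>t. mixed_kernel \<sigma> n (s, t)) n p"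
    "\<And>n s. slice_concentration (\<lambda>t. mixed_kernel \<sigma> n (s, t)) n p \<le> c * slice_concentration (\<lambda>t. dirichlet_kernel n (s + t)) n p"
proof -
  obtain c where c: "c > 0" and eq: "\<And>\<xi> :: nat \<Rightarrow> complex. finite {k. \<xi> k \<noteq> 0} \<Longrightarrow>
       (1 / c) * Lp_norm unit_interval_measure p (\<lambda>t. \<Sum>k | \<xi> k \<noteq> 0. \<xi> k * trig k t)
         \<le> Lp_norm unit_interval_measure p (\<lambda>t. \<Sum>k | \<xi> k \<noteq> 0. \<xi> k * walsh (\<sigma> k) t) \<and>
       Lp_norm unit_interval_measure p (\<lambda>t. \<Sum>k | \<xi> k \<noteq> 0. \<xi> k * walsh (\<sigma> k) t)
         \<le> c * Lp_norm unit_interval_measure p (\<lambda>t. \<Sum>k | \<xi> k \<noteq> 0. \<xi> k * trig k t)"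
    using assms(2) unfolding equivalent_in_Lp_def by blast
  show thesis
  proof (rule that[of "c powr p"])
    show "c powr p > 0" using c by simp
    fix n s
    let ?D = "\<lambda>t. norm (dirichlet_kernel n (s + t))" and ?F = "\<lambda>t. norm (mixed_kernel \<sigma> n (s, t))"
    define \<xi> where "\<xi> = (\<lambda>k. if k < n then trig k s else 0)"
    have supp: "{k. \<xi> k \<noteq> 0} = {..<n}" by (auto simp: \<xi>_def)
    have D: "(\<Sum>k | \<xi> k \<noteq> 0. \<xi> k * trig k t) = dirichlet_kernel n (s + t)" for t
      unfolding supp by (simp add: \<xi>_def trig_add)
    have F: "(\<Sum>k | \<xi> k \<noteq> 0. \<xi> k * walsh (\<sigma> k) t) = mixed_kernel \<sigma> n (s, t)" for t
      unfolding supp by (simp add: \<xi>_def mixed_kernel_def)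
    have "(\<integral>t. ?D t powr p \<partial>unit_interval_measure) powr (1 / p)
          \<le> c * (\<integral>t. ?F t powr p \<partial>unit_interval_measure) powr (1 / p)"
      "(\<integral>t. ?F t powr p \<partial>unit_interval_measure) powr (1 / p)
          \<le> c * (\<integral>t. ?D t powr p \<partial>unit_interval_measure) powr (1 / p)"
      using eq[of \<xi>] c unfolding D F Lp_norm_def by (simp_all add: supp field_simps)
    then have "(\<integral>t. ?D t powr p \<partial>unit_interval_measure)
          \<le> c powr p * (\<integral>t. ?F t powr p \<partial>unit_interval_measure)"
      "(\<integral>t. ?F t powr p \<partial>unit_interval_measure)
          \<le> c powr p * (\<integral>t. ?D t powr p \<partial>unit_interval_measure)"
      using c assms(1) by (auto intro!: powr_inverse_le_imp)
    then show "slice_concentration (\<lambda>t. dirichlet_kernel n (s + t)) n p \<le> c powr p * slice_concentration (\<lambda>t. mixed_kernel \<sigma> n (s, t)) n p"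
      "slice_concentration (\<lambda>t. mixed_kernel \<sigma> n (s, t)) n p \<le> c powr p * slice_concentration (\<lambda>t. dirichlet_kernel n (s + t)) n p"
      unfolding slice_concentration_def mult.left_commute[of _ "real n"]
      by (intro mult_left_mono; simp add: powr_divide divide_right_mono)+
  qed
qed

lemma equivalent_imp_concentration_lower:
  assumes "p > 0" "equivalent_in_Lp p trig (\<lambda>k. walsh (\<sigma> k))"
  obtains c where "c > 0" "\<And>n. n > 0 \<Longrightarrow> c \<le> concentration \<sigma> n p"
proof -
  have p: "p \<ge> 0" using assms by auto
  obtain c where c: "c > 0"
    and cD: "\<And>n s. slice_concentration (\<lambda>t. dirichlet_kernel n (s + t)) n p \<le> c * slice_concentration (\<lambda>t. mixed_kernel \<sigma> n (s, t)) n p"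
    using equivalent_in_Lp_slice[OF assms] by metis
  define d where "d = (1 / 2) powr p / 6"
  have "d / c > 0" using c by (simp add: d_def)
  moreover have "d / c \<le> concentration \<sigma> n p" if n: "n > 0" for n
  proof -
    have "d / c \<le> slice_concentration (\<lambda>t. mixed_kernel \<sigma> n (s, t)) n p" if "s \<in> {0..1}" for s
    proof -
      have "d \<le> slice_concentration (\<lambda>t. dirichlet_kernel n (s + t)) n p"
        unfolding d_def using assms(1) n that by (rule dirichlet_kernel_slice_lower)
      also have "\<dots> \<le> c * slice_concentration (\<lambda>t. mixed_kernel \<sigma> n (s, t)) n p" by (rule cD)
      finally show ?thesis using c by (simp add: field_simps)
    qed
    then have "(\<integral>s. d / c \<partial>unit_interval_measure) \<le> concentration \<sigma> n p"
      unfolding concentration_eq_integral_slices(1)[OF p]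
      by (intro integral_mono concentration_eq_integral_slices(2) p) auto
    then show ?thesis by simp
  qed
  ultimately show thesis by (rule that)
qed

lemma equivalent_imp_concentration_upper:
  assumes "p > 1" "equivalent_in_Lp p trig (\<lambda>k. walsh (\<sigma> k))"
  obtains C where "C > 0" "\<And>n. n > 0 \<Longrightarrow> concentration \<sigma> n p \<le> C"
proof -
  have p: "p > 0" "p \<ge> 0" using assms by auto
  obtain c where c: "c > 0"
    and cF: "\<And>n s. slice_concentration (\<lambda>t. mixed_kernel \<sigma> n (s, t)) n p \<le> c * slice_concentration (\<lambda>t. dirichlet_kernel n (s + t)) n p"
    using equivalent_in_Lp_slice[OF p(1) assms(2)] by metis
  obtain C where C: "C > 0" "\<And>n s. n > 0 \<Longrightarrow> s \<in> {0..1} \<Longrightarrow>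
    slice_concentration (\<lambda>t. dirichlet_kernel n (s + t)) n p \<le> C"
    by (rule dirichlet_kernel_slice_upper[OF assms(1)]) (rule that)
  have "c * C > 0" using c C(1) by simp
  moreover have "concentration \<sigma> n p \<le> c * C" if n: "n > 0" for n
  proof -
    have "slice_concentration (\<lambda>t. mixed_kernel \<sigma> n (s, t)) n p \<le> c * C" if "s \<in> {0..1}" for s
      using cF[of n s] mult_left_mono[OF C(2)[OF n that], of c] c by linarith
    then have "concentration \<sigma> n p \<le> (\<integral>s. c * C \<partial>unit_interval_measure)"
      unfolding concentration_eq_integral_slices(1)[OF p(2)]
      by (intro integral_mono concentration_eq_integral_slices(2) p(2)) auto
    then show ?thesis by simp
  qed
  ultimately show thesis by (rule that)
qed

section \<open>Non-equivalence of the two systems\<close>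

lemma concentration_eq_Lp_norm:
  assumes "p > 0" "n > 0"
  shows "concentration \<sigma> n p
    = (n powr (1 / p - 1) * Lp_norm unit_square_measure p (mixed_kernel \<sigma> n)) powr p"
proof -
  have "(1 / p - 1) * p = 1 - p" using assms by (simp add: field_simps)
  then show ?thesis using assms
    by (simp add: concentration_def Lp_norm_def powr_mult powr_powr powr_divide powr_diff)
qed

lemma small_concentration:
  assumes "p > 0" "\<delta> > 0"
    "liminf (\<lambda>n. ereal (real n powr (1 / p - 1)
        * Lp_norm unit_square_measure p (mixed_kernel \<sigma> n))) = 0"
  obtains n where "n > 0" "concentration \<sigma> n p < \<delta>"
proof -
  let ?a = "\<lambda>n. real n powr (1 / p - 1) * Lp_norm unit_square_measure p (mixed_kernel \<sigma> n)"
  have "\<not> (\<forall>n>0. \<delta> powr (1 / p) \<le> ?a n)"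
  proof
    assume "\<forall>n>0. \<delta> powr (1 / p) \<le> ?a n"
    then have "\<forall>\<^sub>F n in sequentially. ereal (\<delta> powr (1 / p)) \<le> ereal (?a n)"
      by (intro eventually_sequentiallyI[of 1]) auto
    then have "ereal (\<delta> powr (1 / p)) \<le> liminf (\<lambda>n. ereal (?a n))" by (rule Liminf_bounded)
    with assms show False by simp
  qed
  then obtain n where n: "n > 0" "?a n < \<delta> powr (1 / p)" by (auto simp: not_le)
  have "?a n powr p < (\<delta> powr (1 / p)) powr p"
    using n(2) assms(1) by (intro powr_less_mono2) (auto simp: Lp_norm_def)
  then have "concentration \<sigma> n p < \<delta>"
    using assms n(1) by (simp add: concentration_eq_Lp_norm powr_powr)
  with n(1) show thesis by (rule that)
qed

theorem theorem3p2:
  fixes \<sigma> :: "nat \<Rightarrow> nat"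
  assumes "bij \<sigma>"
    and "\<exists>p\<^sub>0::real. p\<^sub>0 > 2 \<and>
      liminf (\<lambda>n. ereal (real n powr (1 / p\<^sub>0 - 1)
        * Lp_norm unit_square_measure p\<^sub>0 (mixed_kernel \<sigma> n))) = 0"
  shows "\<forall>p::real. 1 < p \<and> p \<noteq> 2 \<longrightarrow>
    \<not> equivalent_in_Lp p trig (\<lambda>k. walsh (\<sigma> k))"
proof (intro allI impI notI)
  fix p :: real
  assume p: "1 < p \<and> p \<noteq> 2" and eq: "equivalent_in_Lp p trig (\<lambda>k. walsh (\<sigma> k))"
  from p have "p > 0" "p > 1" by auto
  obtain p\<^sub>0 :: real where p\<^sub>0: "p\<^sub>0 > 2"
    and lim: "liminf (\<lambda>n. ereal (real n powr (1 / p\<^sub>0 - 1)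
        * Lp_norm unit_square_measure p\<^sub>0 (mixed_kernel \<sigma> n))) = 0"
    using assms(2) by blast
  from p\<^sub>0 have "p\<^sub>0 > 0" by simp
  consider "p \<ge> p\<^sub>0" | "2 < p" "p < p\<^sub>0" | "p < 2" using p by linarith
  then show False
  proof cases
    case 1
    obtain c where c: "c > 0" "\<And>n. n > 0 \<Longrightarrow> c \<le> concentration \<sigma> n p"
      by (rule equivalent_imp_concentration_lower[OF \<open>p > 0\<close> eq]) (rule that)
    obtain n where n: "n > 0" "concentration \<sigma> n p\<^sub>0 < c"
      by (rule small_concentration[OF \<open>p\<^sub>0 > 0\<close> c(1) lim]) (rule that)
    show False
      using c(2)[OF n(1)] n(2) concentration_antimono[of p\<^sub>0 p \<sigma> n] 1 p\<^sub>0 by simp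
  next
    case 2
    obtain c where c: "c > 0" "\<And>n. n > 0 \<Longrightarrow> c \<le> concentration \<sigma> n p"
      by (rule equivalent_imp_concentration_lower[OF \<open>p > 0\<close> eq]) (rule that)
    have "c / 2 > 0" using c(1) by simp
    obtain K where K: "K > 0" "\<And>\<sigma> n. concentration \<sigma> n p
        \<le> c / 2 * concentration \<sigma> n 2 + K * concentration \<sigma> n p\<^sub>0"
      by (rule concentration_interpolation[OF _ 2 \<open>c / 2 > 0\<close>]) (simp, rule that)
    have "c / 2 / K > 0" using c(1) K(1) by simp
    obtain n where n: "n > 0" "concentration \<sigma> n p\<^sub>0 < c / 2 / K"
      by (rule small_concentration[OF \<open>p\<^sub>0 > 0\<close> \<open>c / 2 / K > 0\<close> lim]) (rule that)
    have "K * concentration \<sigma> n p\<^sub>0 < c / 2" using n(2) K(1) by (simp add: field_simps)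
    then show False
      using c(2)[OF n(1)] K(2)[of \<sigma> n] n(1) by (simp add: concentration_2)
  next
    case 3
    obtain C where C: "C > 0" "\<And>n. n > 0 \<Longrightarrow> concentration \<sigma> n p \<le> C"
      by (rule equivalent_imp_concentration_upper[OF \<open>p > 1\<close> eq]) (rule that)
    have "1 / (2 * C) > 0" using C(1) by simp
    obtain K where K: "K > 0" "\<And>\<sigma> n. concentration \<sigma> n 2
        \<le> 1 / (2 * C) * concentration \<sigma> n p + K * concentration \<sigma> n p\<^sub>0"
      by (rule concentration_interpolation[OF less_imp_le[OF \<open>p > 0\<close>] 3 p\<^sub>0 \<open>1 / (2 * C) > 0\<close>])
         (rule that)
    have "1 / 2 / K > 0" using K(1) by simp
    obtain n where n: "n > 0" "concentration \<sigma> n p\<^sub>0 < 1 / 2 / K"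
      by (rule small_concentration[OF \<open>p\<^sub>0 > 0\<close> \<open>1 / 2 / K > 0\<close> lim]) (rule that)
    have "K * concentration \<sigma> n p\<^sub>0 < 1 / 2" using n(2) K(1) by (simp add: field_simps)
    moreover have "1 / (2 * C) * concentration \<sigma> n p \<le> 1 / 2"
      using C(1) C(2)[OF n(1)] by (simp add: field_simps)
    ultimately show False
      using K(2)[of \<sigma> n] n(1) by (simp add: concentration_2)
  qed
qed

end
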